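(* Let $k\ge1$, $0\le t\le k$, $n=k+t$, $V=\{1,\dots,n\}$, and let $H_{k,t}=(V,F)$ be the graph with edge set $F=\{\{i,i+k\}:1\le i\le t\}$. Put $V_i=\{i,i+k\}$ for $1\le i\le t$ and $V_i=\{i\}$ for $t+1\le i\le k$ (the node sets of the connected components of $H_{k,t}$). Let $G=(V,E)$ be a graph whose edge set consists of exactly $\binom{k}{2}$ edges, namely for each $1\le i<j\le k$ exactly one edge $e_{ij}$ (also written $e_{ji}$), which joins a node of $V_i$ and a node of $V_j$. Assume $G$ contains a cycle $C$ of length four all of whose four nodes have indices at most $k$, and let $V_C$ be the set of these four nodes. Call a node $i$ of $C$ free if $1\le i\le t$ and the node $i+k$ is an endpoint of the edge $e_{ij}$, where $j$ is the unique node of $C$ not adjacent to $i$ in $C$. Let $I'(G,H_{k,t},C)$ denote the inequality, in variables $x_{uv}$ indexed by the edges of the complete graph on $V\cup\{n+1,n+2\}$, \[ \sum_{uv\in E} T(u,v;n+1)-\sum_{uv\in F}T(u,v;n+1)+2\sum_{i=t+1}^{k}x_{i,n+1}+\sum_{u\in V_C}\bigl(x_{u,n+1}-x_{u,n+2}\bigr)\le 2, \] where $T(u,v;w)=x_{uv}-x_{uw}-x_{vw}$. Suppose that: (i) every node of $G$ has at least two neighbors in $G$; (ii) for each $i$ with $t+1\le i\le k$ and $i\notin V_C$, there exists a free node $j$ of $C$ such that $e_{ij}$ is incident to $j+k$; (iii) for each $i$ with $1\le i\le t$ and $i\notin V_C$, either each of the nodes $i$ and $i+k$ is an endpoint of exactly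 two of the four edges $e_{ij}$ with $j\in V_C$, or there exists a free node $j$ of $C$ such that $e_{ij}$ is incident to $j+k$. Then $I'(G,H_{k,t},C)$ defines a facet of $\mathrm{CUT}^\square_{n+2}$.
   Context: For a graph with node set $W$ and edge set $D$, the cut vector $\boldsymbol{\delta}(S)\in\mathbb{R}^D$ of $S\subseteq W$ has $\delta_{uv}(S)=1$ if exactly one of $u,v$ lies in $S$, and $0$ otherwise. $\mathrm{CUT}^\square_N$ is the cut polytope of $\mathrm{K}_N$: the convex hull of all cut vectors of subsets of the node set of $\mathrm{K}_N$, in $\mathbb{R}^{E(\mathrm{K}_N)}$; here the nodes of $\mathrm{K}_{n+2}$ are $V\cup\{n+1,n+2\}$. An inequality is a facet of a polytope $P$ if it is valid for $P$ and the set of points of $P$ satisfying it with equality has dimension $\dim P-1$. *)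

theory Defs
  imports "HOL-Analysis.Analysis"
begin

definition edges_on :: "'a set \<Rightarrow> 'a set set" where
  "edges_on W = {e. e \<subseteq> W \<and> card e = 2}"

text \<open>For a graph on (a subset of) the finite type \<^typ>\<open>'v\<close> with edge set \<open>D\<close>, the space of real
  vectors indexed by \<open>D\<close> is realised as the coordinate subspace of \<^typ>\<open>real ^ ('v set)\<close> whose
  coordinates outside \<open>D\<close> vanish; affine dimensions do not depend on this embedding.\<close>

definition cut_vector :: "'v::finite set set \<Rightarrow> 'v set \<Rightarrow> real ^ ('v set)" where
  "cut_vector D S = (\<chi> e. if e \<in> D \<and> card (e \<inter> S) = 1 then 1 else 0)"

text \<open>The cut polytope of the complete graph whose node set is the whole type \<^typ>\<open>'v\<close>.\<close>

definition cut_polytope :: "(real ^ ('v::finite set)) set" where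
  "cut_polytope = convex hull (cut_vector (edges_on UNIV) ` Pow UNIV)"

definition defines_facet :: "'a::euclidean_space set \<Rightarrow> ('a \<Rightarrow> real) \<Rightarrow> real \<Rightarrow> bool" where
  "defines_facet P f b \<longleftrightarrow>
     (\<forall>x\<in>P. f x \<le> b) \<and> aff_dim {x \<in> P. f x = b} = aff_dim P - 1"

definition F_edges :: "nat \<Rightarrow> nat \<Rightarrow> nat set set" where
  "F_edges k t = {{i, i + k} | i. 1 \<le> i \<and> i \<le> t}"

definition component :: "nat \<Rightarrow> nat \<Rightarrow> nat \<Rightarrow> nat set" where
  "component k t i = (if i \<le> t then {i, i + k} else {i})"

definition joins :: "nat set \<Rightarrow> nat set \<Rightarrow> nat set \<Rightarrow> bool" where
  "joins e A B \<longleftrightarrow> (\<exists>u\<in>A. \<exists>v\<in>B. e = {u, v})"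

definition linking_edges :: "nat \<Rightarrow> nat \<Rightarrow> nat set set \<Rightarrow> bool" where
  "linking_edges k t E \<longleftrightarrow>
     E \<subseteq> edges_on {1..k + t} \<and> card E = k choose 2 \<and>
     (\<forall>i j. 1 \<le> i \<and> i < j \<and> j \<le> k \<longrightarrow>
        (\<exists>!e. e \<in> E \<and> joins e (component k t i) (component k t j)))"

definition link :: "nat \<Rightarrow> nat \<Rightarrow> nat set set \<Rightarrow> nat \<Rightarrow> nat \<Rightarrow> nat set" where
  "link k t E i j = (THE e. e \<in> E \<and> joins e (component k t i) (component k t j))"

definition neighbors :: "nat set set \<Rightarrow> nat \<Rightarrow> nat set" where
  "neighbors E u = {v. {u, v} \<in> E \<and> v \<noteq> u}"

text \<open>A cycle is given by its edge set \<open>C\<close>; its node set is \<open>\<Union>C\<close>.\<close>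

definition four_cycle :: "'a set set \<Rightarrow> bool" where
  "four_cycle C \<longleftrightarrow>
     (\<exists>a b c d. distinct [a, b, c, d] \<and> C = {{a, b}, {b, c}, {c, d}, {d, a}})"

definition opposite :: "'a set set \<Rightarrow> 'a \<Rightarrow> 'a" where
  "opposite C i = (THE j. j \<in> \<Union>C \<and> j \<noteq> i \<and> {i, j} \<notin> C)"

definition free_node :: "nat \<Rightarrow> nat \<Rightarrow> nat set set \<Rightarrow> nat set set \<Rightarrow> nat \<Rightarrow> bool" where
  "free_node k t E C i \<longleftrightarrow>
     i \<in> \<Union>C \<and> 1 \<le> i \<and> i \<le> t \<and> i + k \<in> link k t E i (opposite C i)"

text \<open>For \<open>e = {u, v}\<close> with \<open>u \<noteq> v\<close>, \<open>T x e w\<close> is \<open>x\<^sub>u\<^sub>v - x\<^sub>u\<^sub>w - x\<^sub>v\<^sub>w\<close>.\<close>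

definition T :: "(nat set \<Rightarrow> real) \<Rightarrow> nat set \<Rightarrow> nat \<Rightarrow> real" where
  "T x e w = x e - (\<Sum>u\<in>e. x {u, w})"

definition I'_lhs :: "nat \<Rightarrow> nat \<Rightarrow> nat set set \<Rightarrow> nat set set \<Rightarrow> (nat set \<Rightarrow> real) \<Rightarrow> real" where
  "I'_lhs k t E C x =
     (let n = k + t in
       (\<Sum>e\<in>E. T x e (n + 1)) - (\<Sum>e\<in>F_edges k t. T x e (n + 1))
       + 2 * (\<Sum>i=t+1..k. x {i, n + 1})
       + (\<Sum>u\<in>\<Union>C. x {u, n + 1} - x {u, n + 2}))"

end

theory Submission
  imports Defs
begin

text \<open>Normalise every shore \<open>S\<close> by complementation so that \<open>n + 1 \<notin> S\<close>. On the cut of \<open>S\<close> the left-hand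
  side is then twice
  \<open>a - e + (if n + 2 \<in> S then \<bar>S \<inter> V\<^sub>C\<bar> - 2 else 0)\<close>,
  where \<open>a\<close> counts the components \<open>V\<^sub>i\<close> contained in \<open>S\<close> and \<open>e\<close> the edges of \<open>G\<close> inside \<open>S\<close>.
  Validity follows from \<open>e \<ge> a choose 2\<close> and from the edges of the four-cycle.

  The right-hand side is nonzero and the empty cut is the origin, so the face is a facet as soon as
  every linear functional vanishing on the tight cuts vanishes on all cuts. Such a functional is a
  quadratic polynomial in the indicator of \<open>S\<close>. The tight shores avoiding \<open>n + 2\<close> (unions of one or
  two components with at most two further nodes adjacent to nothing in the set) kill all its
  coefficients on \<open>V\<close>, using that each node has two neighbours. What remains on the shores containing
  \<open>n + 2\<close> is an affine function \<open>\<gamma> + \<Sum> \<mu>\<^sub>u\<close>. The unions of two and of three components met by the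
  cycle give \<open>\<gamma> = 0\<close> and \<open>\<mu>(V\<^sub>i) = 0\<close> for \<open>i \<in> V\<^sub>C\<close>; a free node \<open>a\<close> with opposite node \<open>c\<close> makes
  \<open>V\<^sub>c \<union> {a}\<close> and suitable \<open>V\<^sub>c \<union> V\<^sub>i \<union> {a}\<close> tight, and these settle the remaining nodes.\<close>

section \<open>Facets and cuts\<close>

text \<open>The origin lies in the polytope but, as \<open>b\<close> is nonzero, not in the affine
  hull of the face. So the affine dimension of the polytope is its linear dimension, and that of the
  face is its linear dimension minus one. The hypothesis \<open>dual\<close> makes the two spans
  equal.\<close>

lemma defines_facet_convex_hullI:
  fixes f :: "'a::euclidean_space \<Rightarrow> real"
  assumes "linear f" and "b \<noteq> 0" and "0 \<in> X" and valid: "\<And>x. x \<in> X \<Longrightarrow> f x \<le> b"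
    and dual: "\<And>c x. (\<And>y. y \<in> X \<Longrightarrow> f y = b \<Longrightarrow> c \<bullet> y = 0) \<Longrightarrow> x \<in> X \<Longrightarrow> c \<bullet> x = 0"
  shows "defines_facet (convex hull X) f b"
proof -
  interpret f: linear f by fact
  define P where "P = convex hull X"
  define Y where "Y = {x \<in> P. f x = b}"
  have XP: "X \<subseteq> P" by (simp add: P_def hull_subset)
  have "convex {x. f x \<le> b}"
    by (auto simp: convex_def f.add f.scaleR intro: convex_bound_le)
  hence "P \<subseteq> {x. f x \<le> b}"
    unfolding P_def by (intro hull_minimal) (auto simp: valid)
  have "X \<subseteq> span Y"
  proof
    fix x assume "x \<in> X"
    \<comment> \<open>The component \<open>z\<close> orthogonal to the face is a functional
      vanishing on all tight points, so \<open>dual\<close> applies with \<open>c = z\<close> and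
      forces \<open>z = 0\<close>.\<close>
    obtain y z where yz: "y \<in> span Y" "\<And>w. w \<in> span Y \<Longrightarrow> orthogonal z w" "x = y + z"
      using orthogonal_subspace_decomp_exists[of Y x] by blast
    have "z \<bullet> x = 0"
    proof (rule dual)
      show "z \<bullet> w = 0" if "w \<in> X" "f w = b" for w
        using that XP yz(2)[of w] by (auto simp: Y_def orthogonal_def span_base)
    qed fact
    moreover have "z \<bullet> y = 0" using yz by (auto simp: orthogonal_def)
    ultimately have "z \<bullet> z = 0" using yz(3) by (simp add: inner_right_distrib)
    thus "x \<in> span Y" using yz by simp
  qed
  hence "P \<subseteq> span Y" unfolding P_def by (intro hull_minimal) (auto simp: subspace_imp_convex)
  hence "span P = span Y"
    by (metis (no_types, lifting) Y_def mem_Collect_eq span_mono span_span subsetI subset_antisym)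
  hence dimPY: "dim P = dim Y" by (metis dim_span)
  have "0 \<in> P" using assms(3) XP by auto
  have "affine {x. f x = b}"
    by (auto simp: affine_def f.add f.scaleR simp flip: distrib_right)
  hence "affine hull Y \<subseteq> {x. f x = b}" by (intro hull_minimal) (auto simp: Y_def)
  hence "0 \<notin> affine hull Y" using \<open>b \<noteq> 0\<close> f.zero by auto
  hence "aff_dim (insert 0 Y) = aff_dim Y + 1" by (simp add: aff_dim_insert)
  moreover have "aff_dim (insert 0 Y) = int (dim Y)"
    by (metis aff_dim_zero dim_span hull_inc insertI1 span_insert_0)
  moreover have "aff_dim P = int (dim P)"
    using \<open>0 \<in> P\<close> by (simp add: aff_dim_zero hull_inc)
  ultimately have "aff_dim Y = aff_dim P - 1" using dimPY by simp
  thus ?thesis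
    using \<open>P \<subseteq> {x. f x \<le> b}\<close> unfolding defines_facet_def Y_def P_def by auto
qed

text \<open>Every edge crossing the cut is oriented from \<open>S\<close> to its complement, which
  makes the crossing edges correspond bijectively to pairs.\<close>

lemma inner_cut_vector:
  fixes c :: "real ^ ('v::finite set)"
  shows "c \<bullet> cut_vector (edges_on UNIV) S = (\<Sum>u\<in>S. \<Sum>v\<in>- S. c $ {u, v})"
proof -
  let ?D = "{e \<in> edges_on UNIV. card (e \<inter> S) = 1}"
  have "bij_betw (\<lambda>(u, v). {u, v}) (S \<times> - S) ?D"
    unfolding bij_betw_def
  proof
    show "inj_on (\<lambda>(u, v). {u, v}) (S \<times> - S)"
      by (auto simp: inj_on_def doubleton_eq_iff)
    show "(\<lambda>(u, v). {u, v}) ` (S \<times> - S) = ?D"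
    proof (intro equalityI subsetI)
      fix e assume "e \<in> (\<lambda>(u, v). {u, v}) ` (S \<times> - S)"
      then obtain u v where "e = {u, v}" "u \<in> S" "v \<notin> S" by auto
      moreover from this have "e \<inter> S = {u}" by auto
      ultimately show "e \<in> ?D" by (auto simp: edges_on_def card_2_iff)
    next
      fix e assume e: "e \<in> ?D"
      then obtain u v where uv: "e = {u, v}" "u \<noteq> v" by (auto simp: edges_on_def card_2_iff)
      obtain w where "e \<inter> S = {w}" using e by (auto simp: card_1_singleton_iff)
      hence "w \<in> e" "w \<in> S" "\<And>y. y \<in> e \<Longrightarrow> y \<in> S \<Longrightarrow> y = w" unfolding set_eq_iff by auto
      hence "(u \<in> S \<and> v \<notin> S) \<or> (v \<in> S \<and> u \<notin> S)" using uv by (metis insertE insertI1 insertI2 singletonD)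
      hence "(u, v) \<in> S \<times> - S \<or> (v, u) \<in> S \<times> - S" by blast
      moreover have "e = {v, u}" using uv(1) by (simp only: insert_commute)
      ultimately show "e \<in> (\<lambda>(u, v). {u, v}) ` (S \<times> - S)" using uv(1) by force
    qed
  qed
  have "c \<bullet> cut_vector (edges_on UNIV) S = (\<Sum>e\<in>?D. c $ e)"
  proof -
    have "c \<bullet> cut_vector (edges_on UNIV) S = (\<Sum>e\<in>UNIV. if e \<in> ?D then c $ e else 0)"
      unfolding inner_vec_def cut_vector_def by (intro sum.cong) simp_all
    also have "\<dots> = (\<Sum>e\<in>?D. c $ e)"
      by (subst sum.inter_restrict[symmetric]) simp_all
    finally show ?thesis .
  qed
  also have "\<dots> = (\<Sum>(u, v)\<in>S \<times> - S. c $ {u, v})"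
    using sum.reindex_bij_betw[OF \<open>bij_betw _ _ ?D\<close>, of "\<lambda>e. c $ e"] by (simp add: case_prod_unfold)
  finally show ?thesis by (simp add: sum.cartesian_product)
qed

lemma cut_vector_Compl:
  fixes D :: "'v::finite set set"
  assumes "D \<subseteq> edges_on UNIV"
  shows "cut_vector D (- S) = cut_vector D S"
proof -
  have "card (e \<inter> - S) = 1 \<longleftrightarrow> card (e \<inter> S) = 1" if "card e = 2" for e
  proof -
    have "card (e \<inter> S) + card (e \<inter> - S) = 2"
      using that by (metis card_Int_Diff diff_eq finite)
    thus ?thesis by linarith
  qed
  thus ?thesis using assms by (auto simp: cut_vector_def vec_eq_iff edges_on_def)
qed

text \<open>As \<open>w\<close> lies outside the shore, \<open>x {u, w}\<close> is the indicator of
  \<open>u\<close>. For indicators p and q of the two ends, \<open>x e\<close> is p + q - 2pq, so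
  the linear terms cancel.\<close>

lemma T_cut:
  assumes "card e = 2" "w \<notin> S" "w \<notin> e"
    and x: "x e = of_bool (card (e \<inter> S) = 1)"
      "\<And>u. u \<in> e \<Longrightarrow> x {u, w} = of_bool (card ({u, w} \<inter> S) = 1)"
  shows "T x e w = - 2 * of_bool (e \<subseteq> S)"
proof -
  obtain u v where e: "e = {u, v}" "u \<noteq> v" using assms(1) by (auto simp: card_2_iff)
  have "{y, w} \<inter> S = (if y \<in> S then {y} else {})" for y using assms(2) by auto
  thus ?thesis using e x by (auto simp: T_def)
qed

text \<open>Cut functions are quadratic polynomials in the indicator of the shore.\<close>

definition quad :: "('a \<Rightarrow> real) \<Rightarrow> ('a \<Rightarrow> 'a \<Rightarrow> real) \<Rightarrow> 'a set \<Rightarrow> real" where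
  "quad \<alpha> \<beta> S = (\<Sum>u\<in>S. \<alpha> u) + (\<Sum>u\<in>S. \<Sum>v\<in>S. \<beta> u v)"

definition bil :: "('a \<Rightarrow> 'a \<Rightarrow> real) \<Rightarrow> 'a set \<Rightarrow> 'a set \<Rightarrow> real" where
  "bil \<beta> X Y = (\<Sum>u\<in>X. \<Sum>v\<in>Y. \<beta> u v)"

lemma bil_commute: "(\<And>u v. \<beta> u v = \<beta> v u) \<Longrightarrow> bil \<beta> X Y = bil \<beta> Y X"
  unfolding bil_def by (subst sum.swap) (auto intro!: sum.cong)

lemma bil_Un_left: "finite X \<Longrightarrow> finite Y \<Longrightarrow> X \<inter> Y = {} \<Longrightarrow> bil \<beta> (X \<union> Y) Z = bil \<beta> X Z + bil \<beta> Y Z"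
  by (simp add: bil_def sum.union_disjoint)

text \<open>The double sum in \<open>quad\<close> runs over ordered pairs, so by symmetry the mixed
  pairs occur twice.\<close>

lemma quad_Un:
  assumes "finite X" "finite Y" "X \<inter> Y = {}" and "\<And>u v. \<beta> u v = \<beta> v u"
  shows "quad \<alpha> \<beta> (X \<union> Y) = quad \<alpha> \<beta> X + quad \<alpha> \<beta> Y + 2 * bil \<beta> X Y"
proof -
  have "(\<Sum>u\<in>Y. \<Sum>v\<in>X. \<beta> u v) = (\<Sum>u\<in>X. \<Sum>v\<in>Y. \<beta> u v)"
    using bil_commute[of \<beta> Y X, OF assms(4)] by (simp add: bil_def)
  thus ?thesis
    using assms(1-3) by (simp add: quad_def bil_def sum.union_disjoint sum.distrib)
qed

section \<open>Shores of extremal gain\<close>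

lemma choose_two_Suc: "Suc m choose 2 = m + (m choose 2)"
  by (simp add: numeral_2_eq_2)

text \<open>With \<open>m\<close> the number of components inside a shore, and at least
  \<open>m choose 2\<close> edges inside it, these bound the gain by 1, 0 and -1
  respectively.\<close>

lemma le_choose_two:
  shows "m \<le> 1 + (m choose 2)"
    and "3 \<le> m \<Longrightarrow> m \<le> m choose 2"
    and "4 \<le> m \<Longrightarrow> m + 1 \<le> m choose 2"
proof -
  show "m \<le> 1 + (m choose 2)"
    by (induction m) (auto simp: choose_two_Suc)
  show le: "m \<le> m choose 2" if "3 \<le> m" for m
    using that by (induction m rule: nat_induct_at_least)
      (auto simp: choose_two_Suc, simp add: choose_two)
  show "m + 1 \<le> m choose 2" if "4 \<le> m"
  proof -
    have "m - 1 \<le> (m - 1) choose 2" using le[of "m - 1"] that by simp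
    thus ?thesis using that choose_two_Suc[of "m - 1"] by simp
  qed
qed

section \<open>Contraction of the components to the nodes of a complete graph\<close>

locale linked_components =
  fixes k t :: nat and E :: "nat set set"
  assumes k_pos: "1 \<le> k" and t_le: "t \<le> k" and linking: "linking_edges k t E"
begin

abbreviation "block \<equiv> component k t"

text \<open>The contraction map: on \<open>{1..k + t}\<close> it gives the index of the component
  containing a node.\<close>

definition idx :: "nat \<Rightarrow> nat" where "idx u = (if u \<le> k then u else u - k)"

text \<open>For a node \<open>u\<close> of another component, this says that \<open>u\<close> is an
  end of the unique edge linking that component to \<open>block i\<close>.\<close>

definition touches :: "nat \<Rightarrow> nat \<Rightarrow> bool" where
  "touches u i \<longleftrightarrow> (\<exists>v\<in>block i. {u, v} \<in> E)"

text \<open>The difference a - e of the outline: half the left-hand side on the cut of a shore that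
  avoids \<open>n + 1\<close> and \<open>n + 2\<close>.\<close>

definition gain :: "nat set \<Rightarrow> real" where
  "gain S = real (card {i \<in> {1..k}. block i \<subseteq> S}) - real (card {e \<in> E. e \<subseteq> S})"

lemma finite_block [simp]: "finite (block i)"
  by (simp add: component_def)

lemma in_block_iff: "i \<in> {1..k} \<Longrightarrow> u \<in> block i \<longleftrightarrow> u \<in> {1..k + t} \<and> idx u = i"
  using t_le by (auto simp: component_def idx_def)

lemma idx_range: "u \<in> {1..k + t} \<Longrightarrow> idx u \<in> {1..k}"
  using t_le by (auto simp: idx_def)

lemma in_block_idx: "u \<in> {1..k + t} \<Longrightarrow> u \<in> block (idx u)"
  using in_block_iff idx_range by blast

lemma block_subset: "i \<in> {1..k} \<Longrightarrow> block i \<subseteq> {1..k + t}"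
  using in_block_iff by blast

lemma block_disjoint: "i \<in> {1..k} \<Longrightarrow> j \<in> {1..k} \<Longrightarrow> i \<noteq> j \<Longrightarrow> block i \<inter> block j = {}"
  by (auto simp: in_block_iff)

lemma self_in_block: "i \<in> block i"
  by (simp add: component_def)

lemma idx_self: "i \<in> {1..k} \<Longrightarrow> idx i = i"
  by (simp add: idx_def)

lemma block_Int_low: "i \<in> {1..k} \<Longrightarrow> block i \<inter> {1..k} = {i}"
  by (auto simp: component_def)

lemma block_twin: "u \<in> {1..k + t} \<Longrightarrow> idx u \<le> t \<Longrightarrow> \<exists>u'. u' \<noteq> u \<and> block (idx u) = {u, u'}"
  using k_pos t_le
  by (cases "u \<le> k") (auto simp: component_def idx_def intro: exI[of _ "u - k"] exI[of _ "u + k"])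

lemma block_single: "t < i \<Longrightarrow> block i = {i}"
  by (simp add: component_def)

lemma edge_card: "e \<in> E \<Longrightarrow> card e = 2" and edge_sub: "e \<in> E \<Longrightarrow> e \<subseteq> {1..k + t}"
  using linking by (auto simp: linking_edges_def edges_on_def)

lemma finite_E [simp]: "finite E"
  using edge_sub finite_subset[of E "Pow {1..k + t}"] by blast

lemma card_edges_on: "finite A \<Longrightarrow> card (edges_on A) = card A choose 2"
  unfolding edges_on_def by (rule n_subsets)

lemma idx_image_joins:
  assumes "joins e (block i) (block j)" "i \<in> {1..k}" "j \<in> {1..k}"
  shows "idx ` e = {i, j}"
  using assms in_block_iff unfolding joins_def by auto

lemma joins_commute: "joins e A B \<longleftrightarrow> joins e B A"
  unfolding joins_def by (metis insert_commute)

lemma ex1_joins: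
  assumes "i \<in> {1..k}" "j \<in> {1..k}" "i \<noteq> j"
  shows "\<exists>!e. e \<in> E \<and> joins e (block i) (block j)"
proof (cases "i < j")
  case True
  thus ?thesis using assms linking by (auto simp: linking_edges_def)
next
  case False
  thus ?thesis using assms linking
    by (subst joins_commute) (auto simp: linking_edges_def)
qed

text \<open>Each pair of components is joined by some edge, so contraction reaches every pair. Since
  \<open>card E\<close> equals the number of pairs, it is also injective; in particular no edge lies
  inside a component.\<close>

lemma bij_idx: "bij_betw (\<lambda>e. idx ` e) E (edges_on {1..k})"
proof -
  have sup: "edges_on {1..k} \<subseteq> (\<lambda>e. idx ` e) ` E"
  proof
    fix p assume "p \<in> edges_on {1..k}"
    then obtain i j where ij: "p = {i, j}" "i \<noteq> j" "i \<in> {1..k}" "j \<in> {1..k}"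
      by (auto simp: edges_on_def card_2_iff)
    then obtain e where "e \<in> E" "joins e (block i) (block j)" using ex1_joins by blast
    thus "p \<in> (\<lambda>e. idx ` e) ` E" using idx_image_joins ij by blast
  qed
  have "card E = card (edges_on {1..k})"
    using linking by (simp add: linking_edges_def card_edges_on)
  hence le: "card ((\<lambda>e. idx ` e) ` E) \<le> card (edges_on {1..k})"
    by (metis card_image_le finite_E)
  hence eq: "(\<lambda>e. idx ` e) ` E = edges_on {1..k}"
    using card_seteq[OF _ sup] by simp
  hence "inj_on (\<lambda>e. idx ` e) E"
    by (intro eq_card_imp_inj_on) (simp_all add: \<open>card E = _\<close>)
  thus ?thesis using eq by (simp add: bij_betw_def)
qed

lemma edge_eqI: "e \<in> E \<Longrightarrow> e' \<in> E \<Longrightarrow> idx ` e = idx ` e' \<Longrightarrow> e = e'"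
  using bij_idx by (auto simp: bij_betw_def inj_on_def)

lemma edge_idx_neq:
  assumes "{u, v} \<in> E"
  shows "idx u \<noteq> idx v"
proof -
  have "idx ` {u, v} \<in> edges_on {1..k}"
    using bij_idx assms unfolding bij_betw_def by blast
  thus ?thesis by (auto simp: edges_on_def)
qed

text \<open>Two such nodes would provide two different edges between the same components. The main
  use: if the twin of a node touches \<open>i\<close>, the node itself does not.\<close>

lemma touches_unique:
  assumes "u \<in> block l" "u' \<in> block l" "u \<noteq> u'" "i \<in> {1..k}" "l \<in> {1..k}"
  shows "\<not> (touches u i \<and> touches u' i)"
proof
  assume "touches u i \<and> touches u' i"
  then obtain v v' where v: "v \<in> block i" "{u, v} \<in> E" "v' \<in> block i" "{u', v'} \<in> E"
    by (auto simp: touches_def)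
  have idx: "idx u = l" "idx u' = l" "idx v' = i" "idx v = i"
    using assms v in_block_iff by blast+
  hence "{u, v} = {u', v'}" using edge_eqI[OF v(2,4)] by simp
  thus False
    using assms(3) idx edge_idx_neq[OF v(2)] by (auto simp: doubleton_eq_iff)
qed

lemma link_props:
  assumes "i \<in> {1..k}" "j \<in> {1..k}" "i \<noteq> j"
  shows "link k t E i j \<in> E" "joins (link k t E i j) (block i) (block j)"
  using theI'[OF ex1_joins[OF assms]] by (simp_all add: link_def)

lemma link_touches:
  assumes "i \<in> {1..k}" "j \<in> {1..k}" "i \<noteq> j" "u \<in> block i" "u \<in> link k t E i j"
  shows "touches u j"
proof -
  obtain x y where xy: "link k t E i j = {x, y}" "x \<in> block i" "y \<in> block j"
    using link_props(2)[OF assms(1-3)] by (auto simp: joins_def)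
  have "u \<noteq> y" using block_disjoint[OF assms(1-3)] assms(4) xy by auto
  thus ?thesis using assms xy link_props(1)[OF assms(1-3)] unfolding touches_def by auto
qed

lemma link_commute: "link k t E i j = link k t E j i"
  unfolding link_def by (subst joins_commute) (rule refl)

text \<open>Under \<open>bij_idx\<close> these edges become all pairs from \<open>A\<close>.\<close>

lemma card_inner_edges:
  assumes "A \<subseteq> {1..k}"
  shows "card {e \<in> E. idx ` e \<subseteq> A} = card A choose 2"
proof -
  have "(\<lambda>e. idx ` e) ` {e \<in> E. idx ` e \<subseteq> A} = edges_on A"
  proof (intro equalityI subsetI)
    fix p assume "p \<in> edges_on A"
    moreover from this have "p \<in> (\<lambda>e. idx ` e) ` E"
      using bij_idx assms by (auto simp: bij_betw_def edges_on_def)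
    ultimately show "p \<in> (\<lambda>e. idx ` e) ` {e \<in> E. idx ` e \<subseteq> A}"
      by (auto simp: edges_on_def)
  qed (use bij_idx in \<open>auto simp: bij_betw_def edges_on_def\<close>)
  moreover have "inj_on (\<lambda>e. idx ` e) {e \<in> E. idx ` e \<subseteq> A}"
    using edge_eqI by (auto simp: inj_on_def)
  ultimately have "card {e \<in> E. idx ` e \<subseteq> A} = card (edges_on A)"
    using card_image by fastforce
  thus ?thesis using card_edges_on finite_subset[OF assms] by simp
qed

section \<open>Full components against inner edges\<close>

lemma edge_within_full:
  assumes "e \<in> E" "idx ` e \<subseteq> {i \<in> {1..k}. block i \<subseteq> S}"
  shows "e \<subseteq> S"
  using assms edge_sub in_block_idx by blast

lemma card_inner_edges_ge:
  "card {i \<in> {1..k}. block i \<subseteq> S} choose 2 \<le> card {e \<in> E. e \<subseteq> S}"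
proof -
  have "{e \<in> E. idx ` e \<subseteq> {i \<in> {1..k}. block i \<subseteq> S}} \<subseteq> {e \<in> E. e \<subseteq> S}"
    using edge_within_full by blast
  thus ?thesis by (subst card_inner_edges[symmetric]) (auto intro!: card_mono)
qed

text \<open>The set \<open>R\<close> takes at most one node from each component it meets, and these
  components have two nodes, so none of them becomes full. Nodes of \<open>R\<close> have no
  neighbour in \<open>S\<close>, so the inner edges are exactly those among the components in
  \<open>I\<close>.\<close>

lemma gain_transversal:
  assumes I: "I \<subseteq> {1..k}" and R: "R \<subseteq> {1..k + t}" and S: "S = (\<Union>i\<in>I. block i) \<union> R"
    and idxR: "\<forall>u\<in>R. idx u \<le> t \<and> idx u \<notin> I" and inj: "inj_on idx R"
    and RI: "\<forall>u\<in>R. \<forall>i\<in>I. \<not> touches u i"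
    and RR: "\<forall>u\<in>R. \<forall>v\<in>R. {u, v} \<notin> E"
  shows "gain S = real (card I) - real (card I choose 2)"
proof -
  have I_iff: "block i \<subseteq> S \<longleftrightarrow> i \<in> I" if "i \<in> {1..k}" for i
  proof
    assume sub: "block i \<subseteq> S"
    show "i \<in> I"
    proof (rule ccontr)
      assume "i \<notin> I"
      have "block i \<subseteq> R"
      proof
        fix u assume u: "u \<in> block i"
        moreover have "u \<notin> block j" if "j \<in> I" for j
        proof -
          have "j \<in> {1..k}" "i \<noteq> j" using I that \<open>i \<notin> I\<close> by auto
          thus ?thesis using block_disjoint[OF \<open>i \<in> {1..k}\<close>] u by blast
        qed
        ultimately show "u \<in> R" using sub S by blast
      qed
      \<comment> \<open>A component inside \<open>R\<close> would have two nodes of equal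
        \<open>idx\<close> there, against \<open>inj\<close>.\<close>
      hence "i \<le> t" using idxR self_in_block[of i] idx_self[OF that] by (metis subsetD)
      hence "i + k \<in> R" "i \<in> R" using \<open>block i \<subseteq> R\<close> by (auto simp: component_def)
      moreover have "idx (i + k) = idx i" using that by (simp add: idx_def)
      ultimately have "i + k = i" using inj_onD[OF inj] by blast
      thus False using k_pos by simp
    qed
  qed (use S in auto)
  have "e \<subseteq> S \<longleftrightarrow> idx ` e \<subseteq> I" if e: "e \<in> E" for e
  proof
    assume sub: "e \<subseteq> S"
    obtain u v where uv: "e = {u, v}" using edge_card[OF e] by (auto simp: card_2_iff)
    have *: "{u, v} \<in> E" "{v, u} \<in> E" using e uv by (simp_all add: insert_commute)
    \<comment> \<open>An edge with an end in \<open>R\<close> has its other end in \<open>R\<close>,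
      excluded by \<open>RR\<close>, or in a component from \<open>I\<close>, excluded by
      \<open>RI\<close>.\<close>
    have "u \<notin> R" "v \<notin> R"
      using sub uv * S RI RR unfolding touches_def by blast+
    thus "idx ` e \<subseteq> I" using sub uv S I in_block_iff by auto
  next
    assume "idx ` e \<subseteq> I"
    thus "e \<subseteq> S" using edge_within_full[OF e, of S] I I_iff by blast
  qed
  hence "{e \<in> E. e \<subseteq> S} = {e \<in> E. idx ` e \<subseteq> I}" by blast
  moreover have "{i \<in> {1..k}. block i \<subseteq> S} = I" using I I_iff by blast
  ultimately show ?thesis using card_inner_edges[OF I] by (simp add: gain_def)
qed

lemma gain_insert_outside:
  assumes "w \<notin> {1..k + t}"
  shows "gain (insert w S) = gain S"
proof -
  have "block i \<subseteq> insert w S \<longleftrightarrow> block i \<subseteq> S" if "i \<in> {1..k}" for i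
    using block_subset[OF that] assms by blast
  moreover have "e \<subseteq> insert w S \<longleftrightarrow> e \<subseteq> S" if "e \<in> E" for e
    using edge_sub[OF that] assms by blast
  ultimately show ?thesis by (simp add: gain_def cong: conj_cong)
qed

lemma gain_le_1: "gain S \<le> 1"
proof -
  define a where "a = card {i \<in> {1..k}. block i \<subseteq> S}"
  have "a \<le> 1 + (a choose 2)" by (rule le_choose_two)
  thus ?thesis using card_inner_edges_ge[of S] unfolding gain_def a_def by linarith
qed

lemma no_loop: "{u} \<notin> E"
  using edge_card[of "{u}"] by auto

section \<open>Concrete shores of gain one and zero\<close>

lemma gain_block:
  assumes "i \<in> {1..k}"
  shows "gain (block i) = 1"
  using gain_transversal[of "{i}" "{}" "block i"] assms by (simp add: binomial_eq_0)

lemma gain_block2: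
  assumes "i \<in> {1..k}" "j \<in> {1..k}" "i \<noteq> j"
  shows "gain (block i \<union> block j) = 1"
  using gain_transversal[of "{i, j}" "{}" "block i \<union> block j"] assms by (simp add: choose_two)

lemma gain_block3:
  assumes "i \<in> {1..k}" "j \<in> {1..k}" "l \<in> {1..k}" "i \<noteq> j" "i \<noteq> l" "j \<noteq> l"
  shows "gain (block i \<union> block j \<union> block l) = 0"
  using gain_transversal[of "{i, j, l}" "{}" "block i \<union> block j \<union> block l"] assms
  by (simp add: Un_assoc choose_two)

lemma gain_block_insert:
  assumes "i \<in> {1..k}" "u \<in> {1..k + t}" "idx u \<le> t" "idx u \<noteq> i" "\<not> touches u i"
  shows "gain (block i \<union> {u}) = 1"
  using gain_transversal[of "{i}" "{u}" "block i \<union> {u}"] assms no_loop[of u] by (simp add: binomial_eq_0)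

lemma gain_block2_insert:
  assumes "i \<in> {1..k}" "j \<in> {1..k}" "i \<noteq> j"
    and "u \<in> {1..k + t}" "idx u \<le> t" "idx u \<noteq> i" "idx u \<noteq> j" "\<not> touches u i" "\<not> touches u j"
  shows "gain (block i \<union> block j \<union> {u}) = 1"
  using gain_transversal[of "{i, j}" "{u}" "block i \<union> block j \<union> {u}"] assms no_loop[of u]
  by (simp add: Un_assoc choose_two)

lemma gain_block_insert2:
  assumes "i \<in> {1..k}" "u \<in> {1..k + t}" "v \<in> {1..k + t}" "idx u \<le> t" "idx v \<le> t"
    and "idx u \<noteq> i" "idx v \<noteq> i" "idx u \<noteq> idx v" "\<not> touches u i" "\<not> touches v i" "{u, v} \<notin> E"
  shows "gain (block i \<union> {u, v}) = 1"
proof -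
  have "{v, u} \<notin> E" "idx u \<notin> idx ` ({v} - {u})" using assms by (auto simp: insert_commute)
  thus ?thesis
    using gain_transversal[of "{i}" "{u, v}" "block i \<union> {u, v}"] assms no_loop[of u] no_loop[of v]
    by (simp add: binomial_eq_0)
qed

text \<open>Two neighbours of \<open>u\<close> lie in different components, because \<open>u\<close>
  sends at most one edge to each.\<close>

lemma touches_two:
  assumes "2 \<le> card (neighbors E u)"
  obtains i j where "i \<in> {1..k}" "j \<in> {1..k}" "i \<noteq> j" "i \<noteq> idx u" "j \<noteq> idx u"
    "touches u i" "touches u j"
proof -
  obtain N where "N \<subseteq> neighbors E u" "card N = 2" using obtain_subset_with_card_n[OF assms] by blast
  then obtain v w where vw: "v \<noteq> w" "{u, v} \<in> E" "{u, w} \<in> E"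
    by (auto simp: card_2_iff neighbors_def)
  have V: "v \<in> {1..k + t}" "w \<in> {1..k + t}" using edge_sub vw by blast+
  have "idx v \<noteq> idx w"
  proof
    assume "idx v = idx w"
    hence "{u, v} = {u, w}" using edge_eqI[OF vw(2,3)] by simp
    thus False using vw(1) by (auto simp: doubleton_eq_iff)
  qed
  thus thesis
    using that[of "idx v" "idx w"] edge_idx_neq[OF vw(2)] edge_idx_neq[OF vw(3)] vw V
      idx_range in_block_idx unfolding touches_def by metis
qed

section \<open>Functionals vanishing on the tight cuts\<close>

text \<open>The coefficients die in the order: sums of \<beta> over pairs of components, then
  \<alpha>, then sums of \<beta> between a component and a node, and finally single values of
  \<beta>.\<close>

lemma quad_vanishes:
  fixes \<alpha> :: "nat \<Rightarrow> real" and \<beta> :: "nat \<Rightarrow> nat \<Rightarrow> real"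
  assumes deg: "\<forall>u\<in>{1..k + t}. 2 \<le> card (neighbors E u)"
    and sym: "\<And>u v. \<beta> u v = \<beta> v u" and diag: "\<And>u. \<beta> u u = 0"
    and tight: "\<And>S. S \<subseteq> {1..k + t} \<Longrightarrow> gain S = 1 \<Longrightarrow> quad \<alpha> \<beta> S = 0"
  shows "u \<in> {1..k + t} \<Longrightarrow> \<alpha> u = 0"
    and "u \<in> {1..k + t} \<Longrightarrow> v \<in> {1..k + t} \<Longrightarrow> \<beta> u v = 0"
proof -
  note Un = quad_Un[of _ _ \<beta> \<alpha>, OF _ _ _ sym]
  have qs: "quad \<alpha> \<beta> {u} = \<alpha> u" for u by (simp add: quad_def diag)
  have q1: "quad \<alpha> \<beta> (block i) = 0" if "i \<in> {1..k}" for i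
    using tight gain_block block_subset that by blast
  have q2: "quad \<alpha> \<beta> (block i \<union> block j) = 0"
    if "i \<in> {1..k}" "j \<in> {1..k}" "i \<noteq> j" for i j
    using tight gain_block2 block_subset that by (meson Un_least)
  have BB: "bil \<beta> (block i) (block j) = 0" if "i \<in> {1..k}" "j \<in> {1..k}" "i \<noteq> j" for i j
    using q2[OF that] Un[of "block i" "block j"] q1 that block_disjoint[OF that] by simp
  have notin: "u \<notin> block i" if "idx u \<noteq> i" "i \<in> {1..k}" for u i
    using in_block_iff that by blast
  have r1: "\<alpha> u + 2 * bil \<beta> (block i) {u} = 0"
    if "u \<in> {1..k + t}" "idx u \<le> t" "i \<in> {1..k}" "i \<noteq> idx u" "\<not> touches u i" for u i
  proof -
    have "quad \<alpha> \<beta> (block i \<union> {u}) = 0"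
    proof (rule tight)
      show "block i \<union> {u} \<subseteq> {1..k + t}" using that block_subset by blast
      show "gain (block i \<union> {u}) = 1" using that by (intro gain_block_insert) auto
    qed
    thus ?thesis using Un[of "block i" "{u}"] q1 that notin qs by auto
  qed
  have r2: "\<alpha> u + 2 * bil \<beta> (block i) {u} + 2 * bil \<beta> (block j) {u} = 0"
    if "u \<in> {1..k + t}" "idx u \<le> t" "i \<in> {1..k}" "i \<noteq> idx u" "\<not> touches u i"
      "j \<in> {1..k}" "j \<noteq> idx u" "\<not> touches u j" "i \<noteq> j" for u i j
  proof -
    have "quad \<alpha> \<beta> (block i \<union> block j \<union> {u}) = 0"
    proof (rule tight)
      show "block i \<union> block j \<union> {u} \<subseteq> {1..k + t}" using that block_subset by blast
      show "gain (block i \<union> block j \<union> {u}) = 1" using that by (intro gain_block2_insert) auto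
    qed
    moreover have "bil \<beta> (block i \<union> block j) {u} = bil \<beta> (block i) {u} + bil \<beta> (block j) {u}"
      using that by (intro bil_Un_left block_disjoint) auto
    moreover have "(block i \<union> block j) \<inter> {u} = {}" using that notin by auto
    ultimately show ?thesis
      using Un[of "block i \<union> block j" "{u}"] q2 that qs by simp
  qed
  have low: "\<alpha> u = 0 \<and> (\<forall>i\<in>{1..k}. i \<noteq> idx u \<and> \<not> touches u i \<longrightarrow> bil \<beta> (block i) {u} = 0)"
    if u: "u \<in> {1..k + t}" "idx u \<le> t" for u
  proof -
    obtain u' where u': "u' \<noteq> u" "block (idx u) = {u, u'}" using block_twin[OF u] by blast
    have "u' \<in> block (idx u)" using u' by simp
    hence u'V: "u' \<in> {1..k + t}" "idx u' = idx u"
      using in_block_iff[OF idx_range[OF u(1)]] by blast+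
    \<comment> \<open>The degree condition is applied to the twin \<open>u'\<close>: whatever
      \<open>u'\<close> touches, \<open>u\<close> does not.\<close>
    obtain i j where ij: "i \<in> {1..k}" "j \<in> {1..k}" "i \<noteq> j" "i \<noteq> idx u" "j \<noteq> idx u"
      "touches u' i" "touches u' j"
      using touches_two[of u'] deg u'V by metis
    have nt: "\<not> touches u i" "\<not> touches u j"
      using touches_unique[of u "idx u" u'] u' ij idx_range[OF u(1)] by auto
    \<comment> \<open>With p and q the two values of \<open>bil\<close>, the relations are \<alpha>
      + 2p = 0, \<alpha> + 2q = 0 and \<alpha> + 2p + 2q = 0 at \<open>u\<close>.\<close>
    have "\<alpha> u = 0"
      using r1[OF u, of i] r1[OF u, of j] r2[OF u, of i j] ij nt by linarith
    thus ?thesis using r1[OF u] by force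
  qed
  \<comment> \<open>At most one of \<open>u\<close> and its twin touches \<open>i\<close>. The other
    one is covered by \<open>low\<close>, and the two values sum to zero by
    \<open>BB\<close>.\<close>
  have B1: "bil \<beta> (block i) {u} = 0"
    if u: "u \<in> {1..k + t}" and i: "i \<in> {1..k}" "i \<noteq> idx u" for u i
  proof (cases "idx u \<le> t")
    case False
    hence "block (idx u) = {u}" using block_single[of "idx u"] in_block_idx[OF u] by auto
    thus ?thesis using BB[of i "idx u"] idx_range[OF u] i by simp
  next
    case True
    obtain u' where u': "u' \<noteq> u" "block (idx u) = {u, u'}" using block_twin[OF u True] by blast
    have "u' \<in> block (idx u)" using u' by simp
    hence u'V: "u' \<in> {1..k + t}" "idx u' = idx u"
      using in_block_iff[OF idx_range[OF u]] by blast+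
    have sum: "bil \<beta> (block i) {u} + bil \<beta> (block i) {u'} = 0"
      using BB[of i "idx u"] idx_range[OF u] i u' by (simp add: bil_def sum.distrib)
    show ?thesis
    proof (cases "touches u i")
      case True
      hence "\<not> touches u' i"
        using touches_unique[of u "idx u" u' i] u' i idx_range[OF u] by auto
      thus ?thesis using low[of u'] u'V i sum True \<open>idx u \<le> t\<close> by auto
    qed (use low[OF u True] i in auto)
  qed
  have \<alpha>0: "\<alpha> u = 0" if u: "u \<in> {1..k + t}" for u
  proof (cases "idx u \<le> t")
    case False
    hence "block (idx u) = {u}" using block_single[of "idx u"] in_block_idx[OF u] by auto
    thus ?thesis using q1[OF idx_range[OF u]] qs by simp
  qed (use low u in auto)
  show "\<alpha> u = 0" if "u \<in> {1..k + t}" using \<alpha>0 that .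
  have same: "\<beta> u v = 0" if "u \<in> {1..k + t}" "v \<in> {1..k + t}" "idx u = idx v" for u v
  proof (cases "u = v")
    case False
    have "{u, v} \<subseteq> block (idx u)" using that in_block_idx by (metis empty_subsetI insert_subset)
    hence uv: "block (idx u) = {u, v}"
      using False by (auto simp: component_def split: if_splits)
    have "quad \<alpha> \<beta> {u, v} = \<alpha> u + \<alpha> v + 2 * \<beta> u v"
      using False sym[of v u] by (simp add: quad_def diag)
    thus ?thesis using q1[OF idx_range[OF that(1)]] uv \<alpha>0 that by simp
  qed (simp add: diag)
  have Bu: "(\<Sum>w\<in>block i. \<beta> w u) = 0" if "u \<in> {1..k + t}" "i \<in> {1..k}" "i \<noteq> idx u" for u i
    using B1[OF that] by (simp add: bil_def)
  have diff: "\<beta> u v = 0" if u: "u \<in> {1..k + t}" and v: "v \<in> {1..k + t}" and ne: "idx u \<noteq> idx v" for u v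
  proof -
    consider "\<not> idx u \<le> t" | "\<not> idx v \<le> t" | "idx u \<le> t" "idx v \<le> t" by blast
    thus ?thesis
    proof cases
      case 1
      hence "block (idx u) = {u}" using block_single[of "idx u"] in_block_idx[OF u] by auto
      thus ?thesis using Bu[OF v idx_range[OF u] ne] by simp
    next
      case 2
      hence "block (idx v) = {v}" using block_single[of "idx v"] in_block_idx[OF v] by auto
      thus ?thesis using Bu[OF u idx_range[OF v]] ne sym[of v u] by simp
    next
      case 3
      \<comment> \<open>The aim is one pair \<open>x\<close>, \<open>y\<close> from the two
        components that is tight together with a third component \<open>i\<close>. Choosing
        \<open>x\<close> as the twin of the end \<open>x0\<close> of the linking edge excludes an
        edge between \<open>x\<close> and \<open>y\<close>. The second neighbour of
        \<open>x0\<close> supplies \<open>i\<close>, which \<open>x\<close> cannot touch, and some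
        node \<open>y\<close> does not touch \<open>i\<close> either.\<close>
      obtain x0 y0 where e: "x0 \<in> block (idx u)" "y0 \<in> block (idx v)" "{x0, y0} \<in> E"
        using ex1_joins[OF idx_range[OF u] idx_range[OF v] ne] by (auto simp: joins_def)
      have x0: "x0 \<in> {1..k + t}" "idx x0 = idx u"
        using e(1) in_block_iff[OF idx_range[OF u]] by blast+
      obtain i where i: "i \<in> {1..k}" "i \<noteq> idx u" "i \<noteq> idx v" "touches x0 i"
        using touches_two[of x0] deg x0 by metis
      obtain x where x: "x \<noteq> x0" "block (idx u) = {x0, x}"
        using block_twin[OF x0(1)] x0(2) 3 by auto
      have "x \<in> block (idx u)" using x by simp
      hence xV: "x \<in> {1..k + t}" "idx x = idx u"
        using in_block_iff[OF idx_range[OF u]] by blast+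
      have xt: "\<not> touches x i"
        using touches_unique[of x "idx u" x0 i] x i idx_range[OF u] by auto
      obtain v' where v': "v' \<noteq> v" "block (idx v) = {v, v'}" using block_twin[OF v 3(2)] by blast
      have "\<not> touches v i \<or> \<not> touches v' i"
        using touches_unique[of v "idx v" v' i] v' i idx_range[OF v] by auto
      then obtain y where y: "y \<in> block (idx v)" "\<not> touches y i" using v' by auto
      have yV: "y \<in> {1..k + t}" "idx y = idx v"
        using y(1) in_block_iff[OF idx_range[OF v]] by blast+
      have nE: "{x, y} \<notin> E"
      proof
        assume "{x, y} \<in> E"
        moreover have "idx y0 = idx v" using e(2) in_block_iff[OF idx_range[OF v]] by blast
        ultimately have "{x, y} = {x0, y0}" using edge_eqI[OF _ e(3)] x0 xV yV by simp
        hence "x = y0" using x(1) by (auto simp: doubleton_eq_iff)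
        thus False using \<open>idx y0 = idx v\<close> xV ne by simp
      qed
      have "quad \<alpha> \<beta> (block i \<union> {x, y}) = 0"
      proof (rule tight)
        show "block i \<union> {x, y} \<subseteq> {1..k + t}" using block_subset[OF i(1)] xV yV by blast
        show "gain (block i \<union> {x, y}) = 1"
          using i xV yV 3 ne y xt nE by (intro gain_block_insert2) auto
      qed
      moreover have "x \<noteq> y" using xV yV ne by auto
      moreover have "quad \<alpha> \<beta> {x, y} = 2 * \<beta> x y"
        using \<open>x \<noteq> y\<close> \<alpha>0 xV yV sym[of y x] by (simp add: quad_def diag)
      moreover have "bil \<beta> (block i) {x, y} = bil \<beta> (block i) {x} + bil \<beta> (block i) {y}"
        using \<open>x \<noteq> y\<close> by (simp add: bil_def sum.distrib)
      ultimately have xy: "\<beta> x y = 0"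
        using Un[of "block i" "{x, y}"] q1[OF i(1)] B1[OF xV(1) i(1)] B1[OF yV(1) i(1)] i xV yV notin
        by auto
      \<comment> \<open>Since the \<beta> values from a fixed node to another component sum to zero,
        one vanishing entry of the two-by-two block spreads to all four.\<close>
      have *: "\<beta> z v = 0" if "z \<in> block (idx u)" "\<beta> z y = 0" for z
      proof (cases "y = v")
        case False
        hence "block (idx v) = {v, y}" using v' y by auto
        moreover have "z \<in> {1..k + t}" "idx z = idx u"
          using that in_block_iff[OF idx_range[OF u]] by blast+
        ultimately have "\<beta> v z + \<beta> y z = 0"
          using Bu[of z "idx v"] idx_range[OF v] ne False by auto
        thus ?thesis using that sym[of z] by simp
      qed (use that in simp)
      have xv: "\<beta> x v = 0" using * xy x by simp
      show ?thesis
      proof (cases "x = u")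
        case False
        hence "block (idx u) = {x, u}" using x in_block_idx[OF u] by auto
        thus ?thesis using Bu[OF v idx_range[OF u] ne] xv False by simp
      qed (use xv in simp)
    qed
  qed
  show "\<beta> u v = 0" if "u \<in> {1..k + t}" "v \<in> {1..k + t}"
    using same diff that by blast
qed

end

section \<open>The four-cycle\<close>

lemma Union_four_cycle:
  assumes "C = {{a, b}, {b, c}, {c, d}, {d, a}}"
  shows "\<Union>C = {a, b, c, d}"
  unfolding assms by blast

lemma card_Union_four_cycle:
  assumes "four_cycle C"
  shows "card (\<Union>C) = 4"
proof -
  obtain p q r s where pqrs: "distinct [p, q, r, s]" "C = {{p, q}, {q, r}, {r, s}, {s, p}}"
    using assms unfolding four_cycle_def by metis
  thus ?thesis using Union_four_cycle[OF pqrs(2)] by simp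
qed

lemma four_cycle_rotate:
  assumes "four_cycle C" "a \<in> \<Union>C"
  obtains b c d where "distinct [a, b, c, d]" "C = {{a, b}, {b, c}, {c, d}, {d, a}}"
proof -
  obtain p q r s where pqrs: "distinct [p, q, r, s]" "C = {{p, q}, {q, r}, {r, s}, {s, p}}"
    using assms(1) unfolding four_cycle_def by metis
  have "a \<in> {p, q, r, s}" using assms(2) Union_four_cycle[OF pqrs(2)] by simp
  then consider "a = p" | "a = q" | "a = r" | "a = s" by blast
  thus thesis
  proof cases
    case 1
    thus ?thesis using that[of q r s] pqrs by simp
  next
    case 2
    show ?thesis
    proof (rule that[of r s p])
      show "C = {{a, r}, {r, s}, {s, p}, {p, a}}" unfolding 2 pqrs(2) by blast
    qed (use 2 pqrs(1) in auto)
  next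
    case 3
    show ?thesis
    proof (rule that[of s p q])
      show "C = {{a, s}, {s, p}, {p, q}, {q, a}}" unfolding 3 pqrs(2) by blast
    qed (use 3 pqrs(1) in auto)
  next
    case 4
    show ?thesis
    proof (rule that[of p q r])
      show "C = {{a, p}, {p, q}, {q, r}, {r, a}}" unfolding 4 pqrs(2) by blast
    qed (use 4 pqrs(1) in auto)
  qed
qed

lemma opposite_four_cycle:
  assumes "distinct [a, b, c, d]" "C = {{a, b}, {b, c}, {c, d}, {d, a}}"
  shows "opposite C a = c"
  unfolding opposite_def
  by (rule the_equality) (use assms in \<open>auto simp: doubleton_eq_iff\<close>)

context linked_components
begin

lemma touches_imp_link:
  assumes "u \<in> block l" "l \<in> {1..k}" "i \<in> {1..k}" "i \<noteq> l" "touches u i"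
  shows "u \<in> link k t E l i"
proof -
  obtain v where v: "v \<in> block i" "{u, v} \<in> E" using assms(5) by (auto simp: touches_def)
  have "idx u = l" "idx v = i" using v assms in_block_iff by blast+
  moreover have "idx ` link k t E l i = {l, i}"
    using idx_image_joins link_props(2) assms by metis
  moreover have "link k t E l i \<in> E" using link_props(1) assms by metis
  ultimately have "link k t E l i = {u, v}" using edge_eqI[OF _ v(2)] by simp
  thus ?thesis by simp
qed

text \<open>This is validity for shores containing \<open>n + 2\<close>. Three cycle nodes in
  \<open>S\<close> force two inner edges and four force four, which suffices for at most two and at
  most three full components respectively; for more, \<open>a choose 2\<close> is large
  enough.\<close>

lemma cut_bound:
  assumes C: "four_cycle C" "C \<subseteq> E"
  shows "gain S + real (card (S \<inter> \<Union>C)) - 2 \<le> 1"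
proof -
  define a where "a = card {i \<in> {1..k}. block i \<subseteq> S}"
  define e where "e = card {e \<in> E. e \<subseteq> S}"
  have gain: "gain S = real a - real e" by (simp add: gain_def a_def e_def)
  have ae: "a choose 2 \<le> e" unfolding a_def e_def by (rule card_inner_edges_ge)
  obtain x b c d where C4: "distinct [x, b, c, d]" "C = {{x, b}, {b, c}, {c, d}, {d, x}}"
    using C unfolding four_cycle_def by metis
  have W: "card (\<Union>C) = 4" "finite (\<Union>C)"
    using card_Union_four_cycle[OF C(1)] Union_four_cycle[OF C4(2)] by simp_all
  have le4: "card (S \<inter> \<Union>C) \<le> 4" using card_mono[of "\<Union>C" "S \<inter> \<Union>C"] W by auto
  consider "card (S \<inter> \<Union>C) \<le> 2" | "card (S \<inter> \<Union>C) = 3" | "card (S \<inter> \<Union>C) = 4"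
    using le4 by linarith
  thus ?thesis
  proof cases
    case 1
    thus ?thesis using gain_le_1[of S] by simp
  next
    case 2
    hence "\<not> \<Union>C \<subseteq> S" using W(1) by (auto simp: Int_absorb1)
    then obtain y where y: "y \<in> \<Union>C" "y \<notin> S" by blast
    \<comment> \<open>Starting the cycle at the missing node \<open>y\<close> turns the other three
      into a path with two edges.\<close>
    obtain p q r where C4: "distinct [y, p, q, r]" "C = {{y, p}, {p, q}, {q, r}, {r, y}}"
      by (rule four_cycle_rotate[OF C(1) y(1)])
    have "S \<inter> \<Union>C = {p, q, r}"
    proof (rule card_subset_eq)
      show "S \<inter> \<Union>C \<subseteq> {p, q, r}" using y(2) Union_four_cycle[OF C4(2)] by auto
      show "card (S \<inter> \<Union>C) = card {p, q, r}" using 2 C4 by simp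
    qed simp
    hence "{p, q} \<subseteq> S" "{q, r} \<subseteq> S" by blast+
    hence "{{p, q}, {q, r}} \<subseteq> {e \<in> E. e \<subseteq> S}" using C4 C(2) by blast
    hence "card {{p, q}, {q, r}} \<le> e" unfolding e_def by (intro card_mono) auto
    moreover have "card {{p, q}, {q, r}} = 2" using C4 by (auto simp: card_2_iff doubleton_eq_iff)
    ultimately have "2 \<le> e" by simp
    hence "a \<le> e" using ae le_choose_two(2)[of a] by (cases "3 \<le> a") auto
    thus ?thesis using gain 2 by simp
  next
    case 3
    hence "S \<inter> \<Union>C = \<Union>C" using W by (intro card_subset_eq) auto
    hence "\<Union>C \<subseteq> S" by blast
    hence "C \<subseteq> {e \<in> E. e \<subseteq> S}" using C(2) by blast
    hence "card C \<le> e" unfolding e_def by (intro card_mono) auto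
    moreover have "card C = 4" using C4 by (auto simp: doubleton_eq_iff)
    ultimately have "a + 1 \<le> e" using ae le_choose_two(3)[of a] by (cases "4 \<le> a") auto
    thus ?thesis using gain 3 by simp
  qed
qed

text \<open>The sets in \<open>tight\<close> are shores that attain equality once
  \<open>n + 2\<close> is added. They determine first \<gamma> and the component sums
  \<open>m i\<close> on the cycle, then the values at free nodes, and from these the remaining
  component sums and nodes.\<close>

lemma linear_vanishes:
  fixes \<gamma> :: real and \<mu> :: "nat \<Rightarrow> real"
  assumes C: "four_cycle C" "C \<subseteq> E" "\<Union>C \<subseteq> {1..k}"
    and ii: "\<forall>i. t + 1 \<le> i \<and> i \<le> k \<and> i \<notin> \<Union>C \<longrightarrow>
               (\<exists>j. free_node k t E C j \<and> j + k \<in> link k t E i j)"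
    and iii: "\<forall>i. 1 \<le> i \<and> i \<le> t \<and> i \<notin> \<Union>C \<longrightarrow>
               (\<forall>u\<in>{i, i + k}. card {j \<in> \<Union>C. u \<in> link k t E i j} = 2) \<or>
               (\<exists>j. free_node k t E C j \<and> j + k \<in> link k t E i j)"
    and tight: "\<And>S. S \<subseteq> {1..k + t} \<Longrightarrow>
        gain S = 1 \<and> card (S \<inter> \<Union>C) = 2 \<or> gain S = 0 \<and> card (S \<inter> \<Union>C) = 3 \<Longrightarrow>
        \<gamma> + (\<Sum>u\<in>S. \<mu> u) = 0"
  shows "\<gamma> = 0" and "u \<in> {1..k + t} \<Longrightarrow> \<mu> u = 0"
proof -
  define W where "W = \<Union>C"
  define m where "m i = (\<Sum>u\<in>block i. \<mu> u)" for i
  have Wk: "W \<subseteq> {1..k}" using C by (simp add: W_def)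
  have Wi: "i \<in> {1..k}" if "i \<in> W" for i using that Wk by blast
  have block_W: "block i \<inter> W = {i} \<inter> W" if "i \<in> {1..k}" for i
    using block_Int_low[OF that] Wk by blast
  have disj: "block i \<inter> block j = {}" if "i \<in> {1..k}" "j \<in> {1..k}" "i \<noteq> j" for i j
    using block_disjoint that by metis
  have t2: "\<gamma> + (\<Sum>u\<in>S. \<mu> u) = 0" if "S \<subseteq> {1..k + t}" "gain S = 1" "card (S \<inter> W) = 2" for S
    using tight that by (simp add: W_def)
  have pair: "\<gamma> + m i + m j = 0" if ij: "i \<in> W" "j \<in> W" "i \<noteq> j" for i j
  proof -
    have "(block i \<union> block j) \<inter> W = {i, j}"
      using block_W[OF Wi[OF ij(1)]] block_W[OF Wi[OF ij(2)]] ij by blast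
    hence "\<gamma> + (\<Sum>u\<in>block i \<union> block j. \<mu> u) = 0"
      using ij Wi block_subset by (intro t2 gain_block2) auto
    thus ?thesis using disj[OF Wi Wi] ij by (simp add: sum.union_disjoint m_def)
  qed
  have triple: "\<gamma> + m i + m j + m l = 0"
    if ijl: "i \<in> W" "j \<in> W" "l \<in> W" "i \<noteq> j" "i \<noteq> l" "j \<noteq> l" for i j l
  proof -
    have "(block i \<union> block j \<union> block l) \<inter> W = {i, j, l}"
      using block_W[OF Wi[OF ijl(1)]] block_W[OF Wi[OF ijl(2)]] block_W[OF Wi[OF ijl(3)]] ijl
      by blast
    moreover have "gain (block i \<union> block j \<union> block l) = 0"
      using ijl Wi by (intro gain_block3) auto
    moreover have "block i \<union> block j \<union> block l \<subseteq> {1..k + t}"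
      using block_subset ijl Wi by (meson Un_least)
    ultimately have "\<gamma> + (\<Sum>u\<in>block i \<union> block j \<union> block l. \<mu> u) = 0"
      using ijl by (intro tight) (auto simp: W_def)
    moreover have "(block i \<union> block j) \<inter> block l = {}" "block i \<inter> block j = {}"
      using disj[of i l] disj[of j l] disj[of i j] ijl Wi by blast+
    ultimately show ?thesis by (simp add: sum.union_disjoint m_def)
  qed
  have \<gamma>m: "\<gamma> = 0 \<and> m i = 0" if i: "i \<in> W" for i
  proof -
    obtain b c d where bcd: "distinct [i, b, c, d]" "C = {{i, b}, {b, c}, {c, d}, {d, i}}"
      by (rule four_cycle_rotate[OF C(1) i[unfolded W_def]])
    have bc: "b \<in> W" "c \<in> W" "i \<noteq> b" "i \<noteq> c" "b \<noteq> c"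
      using bcd(1) Union_four_cycle[OF bcd(2)] by (simp_all add: W_def)
    \<comment> \<open>Subtracting each of the three pair equations from the triple equation kills
      the three component sums, and then \<gamma>.\<close>
    show ?thesis
      using pair[OF i bc(1,3)] pair[OF i bc(2,4)] pair[OF bc(1,2,5)] triple[OF i bc(1,2,3,4,5)]
      by linarith
  qed
  have "W \<noteq> {}" using card_Union_four_cycle[OF C(1)] unfolding W_def by (metis card.empty zero_neq_numeral)
  thus \<gamma>0: "\<gamma> = 0" using \<gamma>m by blast
  have m0: "m i = 0" if "i \<in> W" for i using \<gamma>m that by blast
  \<comment> \<open>The shore \<open>block i \<union> block j \<union> {u}\<close> meets the cycle
    in \<open>i\<close> and \<open>j\<close> only; as \<open>m i\<close> and \<open>m j\<close>
    vanish, \<open>\<mu> u\<close> is left alone.\<close>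
  have two: "\<mu> u = 0"
    if u: "u \<in> {1..k + t}" "idx u \<le> t" "u \<notin> W"
      and ij: "i \<in> W" "j \<in> W" "i \<noteq> j" "idx u \<noteq> i" "idx u \<noteq> j" "\<not> touches u i" "\<not> touches u j"
    for u i j
  proof -
    have nin: "u \<notin> block i" "u \<notin> block j"
      using in_block_iff[OF Wi[OF ij(1)]] in_block_iff[OF Wi[OF ij(2)]] ij by blast+
    have "(block i \<union> block j \<union> {u}) \<inter> W = {i, j}"
      using block_W[OF Wi[OF ij(1)]] block_W[OF Wi[OF ij(2)]] ij u by blast
    hence "card ((block i \<union> block j \<union> {u}) \<inter> W) = 2" using ij by simp
    moreover have "gain (block i \<union> block j \<union> {u}) = 1"
      using u ij Wi by (intro gain_block2_insert) auto
    moreover have "block i \<union> block j \<union> {u} \<subseteq> {1..k + t}"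
      using block_subset[OF Wi[OF ij(1)]] block_subset[OF Wi[OF ij(2)]] u by blast
    ultimately have "\<gamma> + (\<Sum>u\<in>block i \<union> block j \<union> {u}. \<mu> u) = 0" by (intro t2)
    hence "m i + m j + \<mu> u = 0"
      using \<gamma>0 nin disj[OF Wi Wi] ij by (simp add: sum.union_disjoint m_def)
    thus ?thesis using m0 ij by simp
  qed
  \<comment> \<open>The witness is the node opposite to \<open>j\<close>: its edge to
    \<open>block j\<close> ends at \<open>j + k\<close>, hence not at \<open>j\<close>.\<close>
  have free_opp: "\<exists>c\<in>W. c \<noteq> j \<and> j \<in> W \<and> j \<le> t \<and> \<not> touches j c" if "free_node k t E C j" for j
  proof -
    have j: "j \<in> W" "j \<le> t" "j + k \<in> link k t E j (opposite C j)"
      using that by (auto simp: free_node_def W_def)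
    obtain b c d where bcd: "distinct [j, b, c, d]" "C = {{j, b}, {b, c}, {c, d}, {d, j}}"
      by (rule four_cycle_rotate[OF C(1) j(1)[unfolded W_def]])
    have c: "c \<in> W" "c \<noteq> j" using bcd(1) Union_four_cycle[OF bcd(2)] by (auto simp: W_def)
    have blk: "block j = {j, j + k}" using j by (simp add: component_def)
    have "touches (j + k) c"
      using link_touches[of j c "j + k"] j c Wi blk opposite_four_cycle[OF bcd] by auto
    hence "\<not> touches j c" using touches_unique[of j j "j + k" c] blk k_pos j c Wi by auto
    thus ?thesis using j c by blast
  qed
  have free: "\<mu> j = 0" if f: "free_node k t E C j" for j
  proof -
    obtain c where c: "c \<in> W" "c \<noteq> j" "j \<in> W" "j \<le> t" "\<not> touches j c"
      using free_opp[OF f] by blast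
    have nin: "j \<notin> block c" using disj[OF Wi Wi, of c j] c self_in_block[of j] by blast
    have "(block c \<union> {j}) \<inter> W = {c, j}" using block_W[OF Wi[OF c(1)]] c by blast
    hence "card ((block c \<union> {j}) \<inter> W) = 2" using c by simp
    moreover have "gain (block c \<union> {j}) = 1"
      using c Wi[OF c(3)] Wi[OF c(1)] idx_self[OF Wi[OF c(3)]] by (intro gain_block_insert) auto
    moreover have "block c \<union> {j} \<subseteq> {1..k + t}"
      using block_subset[OF Wi[OF c(1)]] Wi[OF c(3)] by auto
    ultimately have "\<gamma> + (\<Sum>u\<in>block c \<union> {j}. \<mu> u) = 0" by (intro t2)
    thus ?thesis using \<gamma>0 nin m0[OF c(1)] by (simp add: m_def)
  qed
  \<comment> \<open>As \<open>j + k\<close> takes the edge to \<open>block i\<close>, the node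
    \<open>j\<close> touches neither \<open>i\<close> nor its opposite \<open>c\<close>. So
    \<open>block c \<union> block i \<union> {j}\<close> has gain 1 and meets the cycle in exactly
    \<open>c\<close> and \<open>j\<close>.\<close>
  have free_m: "m i = 0"
    if i: "i \<in> {1..k}" "i \<notin> W" and f: "free_node k t E C j" "j + k \<in> link k t E i j" for i j
  proof -
    obtain c where c: "c \<in> W" "c \<noteq> j" "j \<in> W" "j \<le> t" "\<not> touches j c"
      using free_opp[OF f(1)] by blast
    have blk: "block j = {j, j + k}" using c by (simp add: component_def)
    have ij: "i \<noteq> j" and ic: "i \<noteq> c" using i c by auto
    have "touches (j + k) i"
      using link_touches[of j i "j + k"] f(2) link_commute[of i j] Wi[OF c(3)] i ij blk by auto
    hence nt: "\<not> touches j i"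
      using touches_unique[of j j "j + k" i] blk k_pos i Wi[OF c(3)] by auto
    have nin: "j \<notin> block c" "j \<notin> block i"
      using disj[OF Wi Wi, of c j] disj[OF i(1) Wi, of j] ij c self_in_block[of j] by blast+
    have "block c \<inter> W = {c}" "block i \<inter> W = {}"
      using block_W[OF Wi[OF c(1)]] block_W[OF i(1)] i(2) c(1) by simp_all
    hence "(block c \<union> block i \<union> {j}) \<inter> W = {j, c}"
      using c(3) by (simp add: Int_Un_distrib2)
    hence "card ((block c \<union> block i \<union> {j}) \<inter> W) = 2" using c by simp
    moreover have "gain (block c \<union> block i \<union> {j}) = 1"
      using c i ij ic nt Wi[OF c(3)] Wi[OF c(1)] idx_self[OF Wi[OF c(3)]]
      by (intro gain_block2_insert) auto
    moreover have "block c \<union> block i \<union> {j} \<subseteq> {1..k + t}"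
      using block_subset[OF Wi[OF c(1)]] block_subset[OF i(1)] Wi[OF c(3)] by auto
    ultimately have "\<gamma> + (\<Sum>u\<in>block c \<union> block i \<union> {j}. \<mu> u) = 0" by (intro t2)
    moreover have "block c \<inter> block i = {}" using disj[OF Wi i(1)] c ic by metis
    ultimately show ?thesis
      using \<gamma>0 nin m0[OF c(1)] free[OF f(1)] by (simp add: sum.union_disjoint m_def)
  qed
  have cardW: "card W = 4" "finite W"
    using card_Union_four_cycle[OF C(1)] card_ge_0_finite[of W] by (simp_all add: W_def)
  \<comment> \<open>At least two of the four cycle nodes remain untouched by \<open>u\<close>, as
    \<open>two\<close> requires.\<close>
  have few: "\<mu> u = 0"
    if u: "u \<in> {1..k + t}" "idx u \<le> t" "idx u \<notin> W" "card {j \<in> W. touches u j} \<le> 2" for u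
  proof -
    have "u \<notin> W"
      using u(3) idx_self Wi by metis
    have "card ({j \<in> W. touches u j} \<union> {j \<in> W. \<not> touches u j})
        = card {j \<in> W. touches u j} + card {j \<in> W. \<not> touches u j}"
      using cardW by (intro card_Un_disjoint) auto
    moreover have "{j \<in> W. touches u j} \<union> {j \<in> W. \<not> touches u j} = W" by blast
    ultimately have "card {j \<in> W. touches u j} + card {j \<in> W. \<not> touches u j} = card W"
      by simp
    hence "2 \<le> card {j \<in> W. \<not> touches u j}" using u(4) cardW by linarith
    then obtain N where "N \<subseteq> {j \<in> W. \<not> touches u j}" "card N = 2"
      by (rule obtain_subset_with_card_n)
    then obtain i j where ij: "i \<in> W" "j \<in> W" "i \<noteq> j" "\<not> touches u i" "\<not> touches u j"
      by (auto simp: card_2_iff)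
    have "idx u \<noteq> i" "idx u \<noteq> j" using u(3) ij by auto
    thus ?thesis using two[OF u(1,2) \<open>u \<notin> W\<close> ij(1-3) _ _ ij(4,5)] by simp
  qed
  have cyc: "\<mu> i = 0 \<and> \<mu> (i + k) = 0" if i: "i \<in> W" "i \<le> t" for i
  proof -
    have blk: "block i = {i, i + k}" using i by (simp add: component_def)
    have sum: "\<mu> i + \<mu> (i + k) = 0" using m0[OF i(1)] blk k_pos by (simp add: m_def)
    show ?thesis
    proof (cases "free_node k t E C i")
      case True
      thus ?thesis using free sum by auto
    next
      case False
      obtain b c d where bcd: "distinct [i, b, c, d]" "C = {{i, b}, {b, c}, {c, d}, {d, i}}"
        by (rule four_cycle_rotate[OF C(1) i(1)[unfolded W_def]])
      have bc: "b \<in> W" "c \<in> W" "b \<noteq> i" "c \<noteq> i" "b \<noteq> c"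
        using bcd(1) Union_four_cycle[OF bcd(2)] by (auto simp: W_def)
      \<comment> \<open>If \<open>i\<close> is not free, then \<open>i + k\<close> touches neither
        \<open>b\<close>, whose edge to \<open>block i\<close> is the cycle edge at
        \<open>i\<close>, nor the opposite node \<open>c\<close>. Thus \<open>two\<close> handles
        \<open>i + k\<close>, and the component sum then handles \<open>i\<close>.\<close>
      have "{i, b} \<in> E" using bcd C(2) by auto
      hence "touches i b" using self_in_block[of b] by (auto simp: touches_def)
      hence 1: "\<not> touches (i + k) b"
        using touches_unique[of i i "i + k" b] blk k_pos Wi bc i by auto
      have "i + k \<notin> link k t E i c"
        using False i Wi[OF i(1)] opposite_four_cycle[OF bcd] by (auto simp: free_node_def W_def)
      hence 2: "\<not> touches (i + k) c"
        using touches_imp_link[of "i + k" i c] blk Wi bc i by auto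
      have "i + k \<in> {1..k + t}" "idx (i + k) = i" "i + k \<notin> W"
        using i Wi[OF i(1)] Wk by (auto simp: idx_def)
      hence "\<mu> (i + k) = 0" using two[of "i + k" b c] i bc 1 2 by metis
      thus ?thesis using sum by simp
    qed
  qed
  have out: "\<mu> i = 0 \<and> \<mu> (i + k) = 0" if i: "1 \<le> i" "i \<le> t" "i \<notin> W" for i
  proof -
    have ik: "i \<in> {1..k}" using i t_le by simp
    have blk: "block i = {i, i + k}" using i by (simp add: component_def)
    have nodes: "i \<in> {1..k + t}" "idx i = i" "i + k \<in> {1..k + t}" "idx (i + k) = i"
      using i t_le by (auto simp: idx_def)
    have link: "{j \<in> W. u \<in> link k t E i j} = {j \<in> W. touches u j}" if "u \<in> block i" for u
      using link_touches[OF ik Wi _ that] touches_imp_link[OF that ik Wi] i(3) by blast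
    consider "\<forall>u\<in>{i, i + k}. card {j \<in> W. u \<in> link k t E i j} = 2"
      | j where "free_node k t E C j" "j + k \<in> link k t E i j"
      using iii[THEN spec, THEN mp, of i] i unfolding W_def by metis
    thus ?thesis
    proof cases
      case 1
      hence "card {j \<in> W. touches i j} = 2" "card {j \<in> W. touches (i + k) j} = 2"
        using link blk by auto
      thus ?thesis using few[of i] few[of "i + k"] nodes i by auto
    next
      case 2
      have sum: "\<mu> i + \<mu> (i + k) = 0"
        using free_m[OF ik i(3) 2] blk k_pos by (simp add: m_def)
      \<comment> \<open>No cycle node is touched by both \<open>i\<close> and \<open>i + k\<close>,
        so one of them touches at most two and falls under \<open>few\<close>; the zero sum settles
        the other.\<close>
      have "{j \<in> W. touches i j} \<inter> {j \<in> W. touches (i + k) j} = {}"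
        using touches_unique[of i i "i + k"] blk k_pos Wi ik by auto
      hence "card {j \<in> W. touches i j} + card {j \<in> W. touches (i + k) j}
          = card ({j \<in> W. touches i j} \<union> {j \<in> W. touches (i + k) j})"
        using cardW by (intro card_Un_disjoint[symmetric]) auto
      also have "\<dots> \<le> card W" using cardW by (intro card_mono) auto
      finally have "card {j \<in> W. touches i j} \<le> 2 \<or> card {j \<in> W. touches (i + k) j} \<le> 2"
        using cardW by linarith
      thus ?thesis using few[of i] few[of "i + k"] nodes i sum by auto
    qed
  qed
  show "\<mu> u = 0" if u: "u \<in> {1..k + t}"
  proof (cases "idx u \<le> t")
    case True
    have "u \<in> {idx u, idx u + k}" using in_block_idx[OF u] True by (simp add: component_def)
    moreover have "\<mu> (idx u) = 0 \<and> \<mu> (idx u + k) = 0"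
      using cyc[of "idx u"] out[of "idx u"] True idx_range[OF u] by auto
    ultimately show ?thesis by auto
  next
    case False
    hence "block (idx u) = {u}" using block_single[of "idx u"] in_block_idx[OF u] by auto
    hence "\<mu> u = m (idx u)" by (simp add: m_def)
    moreover have "m (idx u) = 0"
    proof (cases "idx u \<in> W")
      case outside: False
      moreover have "t + 1 \<le> idx u" "idx u \<le> k" using False idx_range[OF u] by simp_all
      ultimately obtain j where "free_node k t E C j" "j + k \<in> link k t E (idx u) j"
        using ii[THEN spec, THEN mp, of "idx u"] unfolding W_def by metis
      thus ?thesis using free_m[OF idx_range[OF u] outside] by blast
    qed (rule m0)
    ultimately show ?thesis by simp
  qed
qed

end

context linked_components
begin

section \<open>The facet\<close>

text \<open>By \<open>T_cut\<close>, each inner edge of \<open>E\<close> costs 2, and each full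
  two-node component earns 2 through \<open>F_edges\<close>; full singletons earn 2 through the
  separate sum. If \<open>n + 2\<close> lies in \<open>S\<close>, a cycle node adds 1 or -1
  according to whether it lies in \<open>S\<close>, and there are four of them.\<close>

lemma I'_lhs_cut:
  assumes S: "k + t + 1 \<notin> S" and C: "four_cycle C" "\<Union>C \<subseteq> {1..k}"
    and x: "\<And>e. e \<subseteq> {1..k + t + 2} \<Longrightarrow> card e = 2 \<Longrightarrow> x e = of_bool (card (e \<inter> S) = 1)"
  shows "I'_lhs k t E C x =
    2 * gain S + (if k + t + 2 \<in> S then 2 * (real (card (S \<inter> \<Union>C)) - 2) else 0)"
proof -
  define n where "n = k + t"
  have T: "T x e (n + 1) = - 2 * of_bool (e \<subseteq> S)" if "e \<subseteq> {1..n}" "card e = 2" for e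
  proof (rule T_cut)
    show "n + 1 \<notin> e" using that by auto
    show "x {u, n + 1} = of_bool (card ({u, n + 1} \<inter> S) = 1)" if "u \<in> e" for u
    proof (rule x)
      have "u \<in> {1..n}" using that \<open>e \<subseteq> {1..n}\<close> by blast
      thus "{u, n + 1} \<subseteq> {1..k + t + 2}" "card {u, n + 1} = 2" by (auto simp: n_def)
    qed
    show "x e = of_bool (card (e \<inter> S) = 1)"
      by (rule x) (use that in \<open>auto simp: n_def\<close>)
  qed (use S that in \<open>auto simp: n_def\<close>)
  have E: "(\<Sum>e\<in>E. T x e (n + 1)) = - 2 * real (card {e \<in> E. e \<subseteq> S})"
  proof -
    have "(\<Sum>e\<in>E. T x e (n + 1)) = (\<Sum>e\<in>E. - 2 * of_bool (e \<subseteq> S))"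
      by (intro sum.cong refl T) (use edge_sub edge_card in \<open>auto simp: n_def\<close>)
    thus ?thesis by (simp add: sum_distrib_left[symmetric] sum_negf Int_def)
  qed
  have inj: "inj_on (\<lambda>i. {i, i + k}) {1..t}"
    by (auto simp: inj_on_def doubleton_eq_iff)
  have F_img: "F_edges k t = (\<lambda>i. {i, i + k}) ` {1..t}"
    by (auto simp: F_edges_def)
  have F: "(\<Sum>e\<in>F_edges k t. T x e (n + 1)) = - 2 * real (card {i \<in> {1..t}. block i \<subseteq> S})"
  proof -
    have "(\<Sum>e\<in>F_edges k t. T x e (n + 1)) = (\<Sum>i\<in>{1..t}. T x {i, i + k} (n + 1))"
      unfolding F_img using inj by (simp add: sum.reindex)
    also have "\<dots> = (\<Sum>i\<in>{1..t}. - 2 * of_bool (block i \<subseteq> S))"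
    proof (intro sum.cong refl)
      fix i assume i: "i \<in> {1..t}"
      hence blk: "block i = {i, i + k}" by (simp add: component_def)
      have "{i, i + k} \<subseteq> {1..n}" "card {i, i + k} = 2" using i t_le k_pos by (auto simp: n_def)
      thus "T x {i, i + k} (n + 1) = - 2 * of_bool (block i \<subseteq> S)" using T blk by metis
    qed
    also have "\<dots> = - 2 * real (card {i \<in> {1..t}. block i \<subseteq> S})"
      by (simp only: sum_distrib_left[symmetric] sum_of_bool_eq finite_atLeastAtMost Int_def
          mem_Collect_eq)
    finally show ?thesis .
  qed
  have x1: "x {u, n + 1} = of_bool (u \<in> S)" if "u \<in> {1..n}" for u
  proof -
    have "{u, n + 1} \<inter> S = (if u \<in> S then {u} else {})" using S by (auto simp: n_def)
    moreover have "x {u, n + 1} = of_bool (card ({u, n + 1} \<inter> S) = 1)"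
      by (rule x) (use that in \<open>auto simp: n_def\<close>)
    ultimately show ?thesis by simp
  qed
  have x2: "x {u, n + 2} = (if n + 2 \<in> S then 1 - of_bool (u \<in> S) else of_bool (u \<in> S))"
    if "u \<in> {1..n}" for u
  proof -
    have "u \<noteq> n + 2" using that by auto
    hence "{u, n + 2} \<inter> S = (if u \<in> S then {u} else {}) \<union> (if n + 2 \<in> S then {n + 2} else {})"
      by auto
    moreover have "x {u, n + 2} = of_bool (card ({u, n + 2} \<inter> S) = 1)"
      by (rule x) (use that in \<open>auto simp: n_def\<close>)
    ultimately show ?thesis using \<open>u \<noteq> n + 2\<close> by simp
  qed
  have singles: "(\<Sum>i=t+1..k. x {i, n + 1}) = real (card {i \<in> {t+1..k}. block i \<subseteq> S})"
  proof -
    have "(\<Sum>i=t+1..k. x {i, n + 1}) = (\<Sum>i=t+1..k. of_bool (block i \<subseteq> S))"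
      by (intro sum.cong refl) (subst x1, auto simp: block_single n_def)
    thus ?thesis by (simp add: Int_def)
  qed
  have "{i \<in> {1..k}. block i \<subseteq> S} =
      {i \<in> {1..t}. block i \<subseteq> S} \<union> {i \<in> {t+1..k}. block i \<subseteq> S}"
    using t_le by auto
  hence full: "card {i \<in> {1..k}. block i \<subseteq> S} =
      card {i \<in> {1..t}. block i \<subseteq> S} + card {i \<in> {t+1..k}. block i \<subseteq> S}"
    by (simp add: card_Un_disjoint disjoint_iff)
  have cyc: "(\<Sum>u\<in>\<Union>C. x {u, n + 1} - x {u, n + 2}) =
      (if n + 2 \<in> S then 2 * (real (card (S \<inter> \<Union>C)) - 2) else 0)"
  proof -
    have fin: "finite (\<Union>C)" and c4: "card (\<Union>C) = 4"
      using card_Union_four_cycle[OF C(1)] finite_subset[OF C(2)] by simp_all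
    have "(\<Sum>u\<in>\<Union>C. x {u, n + 1} - x {u, n + 2}) =
        (\<Sum>u\<in>\<Union>C. if n + 2 \<in> S then 2 * of_bool (u \<in> S) - 1 else 0)"
    proof (intro sum.cong refl)
      fix u assume "u \<in> \<Union>C"
      hence "u \<in> {1..n}" using C(2) by (auto simp: n_def)
      thus "x {u, n + 1} - x {u, n + 2} = (if n + 2 \<in> S then 2 * of_bool (u \<in> S) - 1 else 0)"
        using x1 x2 by simp
    qed
    also have "\<dots> = (if n + 2 \<in> S then 2 * (\<Sum>u\<in>\<Union>C. of_bool (u \<in> S)) - real (card (\<Union>C)) else 0)"
      by (simp add: sum_subtractf sum_distrib_left)
    also have "(\<Sum>u\<in>\<Union>C. of_bool (u \<in> S)) = real (card (S \<inter> \<Union>C))"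
      using fin by (simp add: Int_commute)
    finally show ?thesis using c4 by simp
  qed
  show ?thesis
    unfolding I'_lhs_def Let_def n_def[symmetric] E F singles cyc gain_def full by simp
qed

end

lemma linear_I'_lhs: "linear (\<lambda>x :: real ^ 'a. I'_lhs k t E C (\<lambda>e. x $ f e))"
proof -
  have nth: "linear (\<lambda>x :: real ^ 'a. x $ i)" for i
    by (rule bounded_linear.linear) (rule bounded_linear_vec_nth)
  have scale: "linear (\<lambda>x. c * g x)" if "linear g" for c and g :: "real ^ 'a \<Rightarrow> real"
    using linear_compose_scale_right[OF that, of c] by simp
  have T: "linear (\<lambda>x. T (\<lambda>e. x $ f e) e w)" for e w
    unfolding T_def by (intro linear_compose_sub linear_compose_sum ballI nth)
  show ?thesis
    unfolding I'_lhs_def Let_def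
    by (intro linear_compose_add linear_compose_sub linear_compose_sum ballI T nth scale)
qed

text \<open>The polytope lives on the complete graph of a whole finite type, so \<open>node\<close>
  labels that type by \<open>{1..n + 2}\<close> and edge coordinates are read through its
  images.\<close>

theorem theorem5:
  fixes k t n :: nat
    and E C :: "nat set set"
    and node :: "nat \<Rightarrow> 'v::finite"
  assumes "1 \<le> k" and "t \<le> k" and "n = k + t"
    and node: "bij_betw node {1..n + 2} (UNIV :: 'v set)"
    and G: "linking_edges k t E"
    and C: "four_cycle C" "C \<subseteq> E" "\<Union>C \<subseteq> {1..k}"
    and i: "\<forall>u\<in>{1..n}. 2 \<le> card (neighbors E u)"
    and ii: "\<forall>i. t + 1 \<le> i \<and> i \<le> k \<and> i \<notin> \<Union>C \<longrightarrow>
               (\<exists>j. free_node k t E C j \<and> j + k \<in> link k t E i j)"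
    and iii: "\<forall>i. 1 \<le> i \<and> i \<le> t \<and> i \<notin> \<Union>C \<longrightarrow>
               (\<forall>u\<in>{i, i + k}. card {j \<in> \<Union>C. u \<in> link k t E i j} = 2) \<or>
               (\<exists>j. free_node k t E C j \<and> j + k \<in> link k t E i j)"
  shows "defines_facet (cut_polytope :: (real ^ ('v set)) set)
           (\<lambda>x. I'_lhs k t E C (\<lambda>e. x $ (node ` e))) 2"
proof -
  interpret linked_components k t E
    using assms by unfold_locales
  define W where "W = {1..n + 2}"
  define \<delta> :: "'v set \<Rightarrow> real ^ ('v set)" where "\<delta> = cut_vector (edges_on UNIV)"
  define f where "f x = I'_lhs k t E C (\<lambda>e. x $ (node ` e))" for x :: "real ^ ('v set)"
  have inj: "inj_on node W" and im: "node ` W = UNIV"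
    using node by (auto simp: bij_betw_def W_def)
  have coord: "\<delta> (node ` S) $ (node ` e) = of_bool (card (e \<inter> S) = 1)"
    if "S \<subseteq> W" "e \<subseteq> W" "card e = 2" for S e
  proof -
    have "card (node ` e) = 2" using that inj by (metis card_image inj_on_subset)
    moreover have "node ` e \<inter> node ` S = node ` (e \<inter> S)"
      using inj_on_image_Int[OF inj] that by simp
    moreover have "card (node ` (e \<inter> S)) = card (e \<inter> S)"
      using that by (intro card_image inj_on_subset[OF inj]) auto
    ultimately show ?thesis by (simp add: \<delta>_def cut_vector_def edges_on_def)
  qed
  have f_cut: "f (\<delta> (node ` S)) =
      2 * gain S + (if n + 2 \<in> S then 2 * (real (card (S \<inter> \<Union>C)) - 2) else 0)"
    if "S \<subseteq> W - {n + 1}" for S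
    unfolding f_def \<open>n = k + t\<close>
  proof (rule I'_lhs_cut)
    show "\<delta> (node ` S) $ (node ` e) = of_bool (card (e \<inter> S) = 1)"
      if "e \<subseteq> {1..k + t + 2}" "card e = 2" for e
      by (rule coord) (use that \<open>S \<subseteq> W - {n + 1}\<close> in \<open>auto simp: W_def \<open>n = k + t\<close>\<close>)
  qed (use that C \<open>n = k + t\<close> in auto)
  \<comment> \<open>Complementary shores give the same cut, so one avoiding \<open>n + 1\<close> can
    be chosen, as \<open>f_cut\<close> requires.\<close>
  have rep: "\<exists>S. S \<subseteq> W - {n + 1} \<and> \<delta> R = \<delta> (node ` S)" for R
  proof -
    define S where "S = {u \<in> W. node u \<in> R}"
    have S: "node ` S = R" using im by (auto simp: S_def image_iff)
    show ?thesis
    proof (cases "n + 1 \<in> S")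
      case True
      have "node ` (W - S) = - R"
        using inj_on_image_set_diff[OF inj, of W S] im S by (auto simp: S_def)
      hence "\<delta> R = \<delta> (node ` (W - S))" by (simp add: \<delta>_def cut_vector_Compl)
      thus ?thesis using True by blast
    next
      case False
      thus ?thesis using S by (intro exI[of _ S]) (auto simp: S_def)
    qed
  qed
  have "defines_facet (convex hull (\<delta> ` Pow UNIV)) f 2"
  proof (rule defines_facet_convex_hullI)
    show "linear f" unfolding f_def by (rule linear_I'_lhs)
    have "\<delta> {} = 0" by (simp add: \<delta>_def cut_vector_def vec_eq_iff)
    thus "0 \<in> \<delta> ` Pow UNIV" by (metis Pow_bottom imageI)
  next
    fix x assume "x \<in> \<delta> ` Pow UNIV"
    then obtain S where S: "S \<subseteq> W - {n + 1}" "x = \<delta> (node ` S)" using rep by blast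
    show "f x \<le> 2"
      using f_cut[OF S(1)] gain_le_1[of S] cut_bound[OF C(1,2), of S] S(2)
      by (cases "n + 2 \<in> S") auto
  next
    fix c x
    assume tight: "\<And>y. y \<in> \<delta> ` Pow UNIV \<Longrightarrow> f y = 2 \<Longrightarrow> c \<bullet> y = 0" and x: "x \<in> \<delta> ` Pow UNIV"
    \<comment> \<open>The weight of a cut is the sum of the weighted degrees over the shore minus
      the weights of all ordered pairs inside it; \<open>\<alpha> u\<close> is the degree and
      \<beta> the negated weight. The value 0 on the diagonal discards the coordinates of
      \<open>c\<close> at singletons, which are not edges.\<close>
    define \<beta> where "\<beta> u v = (if u = v then 0 else - c $ (node ` {u, v}))" for u v
    define \<alpha> where "\<alpha> u = - (\<Sum>v\<in>W. \<beta> u v)" for u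
    have sym: "\<beta> u v = \<beta> v u" and diag: "\<beta> u u = 0" for u v
      by (simp_all add: \<beta>_def insert_commute)
    have quad: "c \<bullet> \<delta> (node ` S) = quad \<alpha> \<beta> S" if S: "S \<subseteq> W" for S
    proof -
      have fin: "finite W" by (simp add: W_def)
      have "- node ` S = node ` (W - S)"
        using inj_on_image_set_diff[OF inj, of W S] im S by auto
      hence "c \<bullet> \<delta> (node ` S) = (\<Sum>u\<in>node ` S. \<Sum>v\<in>node ` (W - S). c $ {u, v})"
        by (simp add: \<delta>_def inner_cut_vector)
      also have "\<dots> = (\<Sum>u\<in>S. \<Sum>v\<in>W - S. c $ {node u, node v})"
        using S inj by (simp add: sum.reindex inj_on_subset[OF inj])
      also have "\<dots> = (\<Sum>u\<in>S. \<Sum>v\<in>W - S. - \<beta> u v)"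
        by (intro sum.cong refl) (auto simp: \<beta>_def)
      also have "\<dots> = (\<Sum>u\<in>S. \<alpha> u + (\<Sum>v\<in>S. \<beta> u v))"
        using S fin by (intro sum.cong refl) (simp add: \<alpha>_def sum_negf sum_diff)
      finally show ?thesis by (simp add: quad_def sum.distrib)
    qed
    have VW: "S \<subseteq> W - {n + 1}" "n + 2 \<notin> S" if "S \<subseteq> {1..k + t}" for S
      using that by (auto simp: W_def \<open>n = k + t\<close>)
    have quad0: "quad \<alpha> \<beta> S = 0" if "S \<subseteq> W - {n + 1}" "f (\<delta> (node ` S)) = 2" for S
    proof -
      have "c \<bullet> \<delta> (node ` S) = 0" using tight that(2) by blast
      thus ?thesis using quad[of S] that(1) by auto
    qed
    have "quad \<alpha> \<beta> S = 0" if "S \<subseteq> {1..k + t}" "gain S = 1" for S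
      using quad0[OF VW(1)[OF that(1)]] f_cut[OF VW(1)[OF that(1)]] VW(2)[OF that(1)] that(2)
      by simp
    note low = quad_vanishes[of \<beta> \<alpha>, OF i[unfolded \<open>n = k + t\<close>] sym diag this]
    have low0: "quad \<alpha> \<beta> S = 0" if "S \<subseteq> {1..k + t}" for S
      unfolding quad_def
      using that low by (simp add: subset_iff sum.neutral)
    \<comment> \<open>Only terms involving \<open>n + 2\<close> survive, leaving the affine function
      to which \<open>linear_vanishes\<close> applies, with \<gamma> =
      \<open>\<alpha> (n + 2)\<close> and \<open>\<mu> u\<close> =
      \<open>2 * \<beta> u (n + 2)\<close>.\<close>
    have ins: "quad \<alpha> \<beta> (insert (n + 2) S) = \<alpha> (n + 2) + (\<Sum>u\<in>S. 2 * \<beta> u (n + 2))"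
      if S: "S \<subseteq> {1..k + t}" for S
    proof -
      have "finite S" using S finite_subset by auto
      hence "quad \<alpha> \<beta> (S \<union> {n + 2}) = quad \<alpha> \<beta> S + quad \<alpha> \<beta> {n + 2} + 2 * bil \<beta> S {n + 2}"
        using VW(2)[OF S] by (intro quad_Un sym) auto
      thus ?thesis
        using low0[OF S] by (simp add: bil_def quad_def diag sum_distrib_left)
    qed
    have "\<alpha> (n + 2) + (\<Sum>u\<in>S. 2 * \<beta> u (n + 2)) = 0"
      if S: "S \<subseteq> {1..k + t}"
        and g: "gain S = 1 \<and> card (S \<inter> \<Union>C) = 2 \<or> gain S = 0 \<and> card (S \<inter> \<Union>C) = 3" for S
    proof -
      have sub: "insert (n + 2) S \<subseteq> W - {n + 1}" using VW[OF S] by (auto simp: W_def)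
      have "n + 2 \<notin> \<Union>C" using C(3) by (auto simp: \<open>n = k + t\<close>)
      hence "insert (n + 2) S \<inter> \<Union>C = S \<inter> \<Union>C" by blast
      moreover have "gain (insert (n + 2) S) = gain S"
        by (rule gain_insert_outside) (simp add: \<open>n = k + t\<close>)
      \<comment> \<open>Both alternatives in \<open>g\<close> give the value 2: either 2 + 0 or 0 +
        2.\<close>
      ultimately have "f (\<delta> (node ` insert (n + 2) S)) = 2" using f_cut[OF sub] g by auto
      thus ?thesis using quad0[OF sub] ins[OF S] by simp
    qed
    note high = linear_vanishes[OF C ii iii this]
    obtain S where S: "S \<subseteq> W - {n + 1}" "x = \<delta> (node ` S)" using x rep by blast
    define S' where "S' = S - {n + 2}"
    have S': "S' \<subseteq> {1..k + t}"
    proof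
      fix u assume "u \<in> S'"
      hence "u \<in> {1..n + 2}" "u \<noteq> n + 1" "u \<noteq> n + 2" using S(1) by (auto simp: S'_def W_def)
      thus "u \<in> {1..k + t}" using \<open>n = k + t\<close> by auto
    qed
    have "quad \<alpha> \<beta> S = 0"
    proof (cases "n + 2 \<in> S")
      case True
      hence "S = insert (n + 2) S'" by (auto simp: S'_def)
      thus ?thesis using ins[OF S'] high S' by (simp add: subset_iff sum.neutral)
    next
      case False
      thus ?thesis using low0[OF S'] by (simp add: S'_def)
    qed
    thus "c \<bullet> x = 0" using quad[of S] S by auto
  qed simp
  thus ?thesis by (simp add: cut_polytope_def \<delta>_def f_def[abs_def])
qed

end
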